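(* The harmonic map $f:\mathbb{C}\to\mathbb{R}^3$, $f(z)=\operatorname{Re}\int^z(\omega_1,\omega_2,\omega_3)$, given by $$\omega_1=i\,dz,\qquad \omega_2=iz^3\,dz,\qquad \omega_3=\left(z^6+1\right)dz$$ is a regular proper embedding.
   Context: A map is regular if it is an immersion. A regular proper embedding is a proper injective immersion. The integral is taken from a fixed base point in $\mathbb{C}$. *)

theory Defs
  imports "HOL-Complex_Analysis.Complex_Analysis"
begin

text \<open>
  In finite dimensions, a map is \<open>C\<^sup>n\<^sup>+\<^sup>1\<close> iff it is differentiable and all its directional
  derivatives are \<open>C\<^sup>n\<close>. The domain is always the whole space. The type \<^typ>\<open>complex\<close> is used
  below as the real plane: \<^const>\<open>frechet_derivative\<close> is the real derivative.
\<close>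

primrec Cn_map :: "nat \<Rightarrow> ('a::euclidean_space \<Rightarrow> 'b::euclidean_space) \<Rightarrow> bool" where
  "Cn_map 0 f \<longleftrightarrow> continuous_on UNIV f"
| "Cn_map (Suc n) f \<longleftrightarrow>
     (\<forall>x. f differentiable at x) \<and> (\<forall>v. Cn_map n (\<lambda>x. frechet_derivative f (at x) v))"

definition smooth_map :: "('a::euclidean_space \<Rightarrow> 'b::euclidean_space) \<Rightarrow> bool" where
  "smooth_map f \<longleftrightarrow> (\<forall>n. Cn_map n f)"

definition laplacian :: "('a::euclidean_space \<Rightarrow> 'b::euclidean_space) \<Rightarrow> 'a \<Rightarrow> 'b" where
  "laplacian f x =
     (\<Sum>b\<in>Basis. frechet_derivative (\<lambda>y. frechet_derivative f (at y) b) (at x) b)"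

definition harmonic_map :: "('a::euclidean_space \<Rightarrow> 'b::euclidean_space) \<Rightarrow> bool" where
  "harmonic_map f \<longleftrightarrow> smooth_map f \<and> (\<forall>x. laplacian f x = 0)"

definition immersion :: "('a::euclidean_space \<Rightarrow> 'b::euclidean_space) \<Rightarrow> bool" where
  "immersion f \<longleftrightarrow> smooth_map f \<and> (\<forall>x. inj (frechet_derivative f (at x)))"

definition regular_proper_embedding :: "('a::euclidean_space \<Rightarrow> 'b::euclidean_space) \<Rightarrow> bool" where
  "regular_proper_embedding f \<longleftrightarrow>
     immersion f \<and> inj f \<and> proper_map euclidean euclidean f"

text \<open>
  The library's \<^const>\<open>proper_map\<close> means ``closed with compact fibres''. For continuous maps
  between Euclidean spaces this is the usual condition on preimages of compact sets:
\<close>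

lemma proper_map_euclidean_iff:
  fixes f :: "'a::euclidean_space \<Rightarrow> 'b::euclidean_space"
  assumes "continuous_on UNIV f"
  shows "proper_map euclidean euclidean f \<longleftrightarrow> (\<forall>K. compact K \<longrightarrow> compact (f -` K))"
proof
  assume "proper_map euclidean euclidean f"
  then show "\<forall>K. compact K \<longrightarrow> compact (f -` K)"
    using compactin_proper_map_preimage[of euclidean euclidean f] by (auto simp: vimage_def)
next
  assume K: "\<forall>K. compact K \<longrightarrow> compact (f -` K)"
  have "k_space (euclidean :: 'b topology)"
    by (simp add: metrizable_imp_k_space metrizable_space_euclidean)
  then show "proper_map euclidean euclidean f"
    using assms K by (intro compact_imp_proper_map) (auto simp: vimage_def Hausdorff_imp_kc_space)
qed

text \<open>
  The forms \<open>\<phi> k dz\<close> are encoded by their coefficient functions. The integral is taken along the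
  segment from the base point \<open>z0\<close>; for entire coefficients any other path gives the same value.
\<close>

definition Re_integral :: "complex \<Rightarrow> (complex \<Rightarrow> complex ^ 'n) \<Rightarrow> complex \<Rightarrow> real ^ 'n" where
  "Re_integral z0 \<phi> z = (\<chi> k. Re (contour_integral (linepath z0 z) (\<lambda>w. \<phi> w $ k)))"

lemma contour_integral_entire_eq_linepath:
  assumes "g holomorphic_on UNIV" "valid_path \<gamma>" "pathstart \<gamma> = z0" "pathfinish \<gamma> = z"
  shows "contour_integral \<gamma> g = contour_integral (linepath z0 z) g"
proof -
  obtain G where G: "\<And>w. (G has_field_derivative g w) (at w)"
    using holomorphic_convex_primitive'[of UNIV g] assms(1) by auto
  have "(g has_contour_integral (G z - G z0)) \<delta>"
    if "valid_path \<delta>" "pathstart \<delta> = z0" "pathfinish \<delta> = z" for \<delta>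
    using contour_integral_primitive[of UNIV G g \<delta>] G that by auto
  from this[of \<gamma>] this[of "linepath z0 z"] assms show ?thesis
    by (simp add: contour_integral_unique)
qed

end

theory Submission
  imports Defs
begin

text \<open>
  The real part of an entire curve is smooth, and its Laplacian vanishes because \<open>1\<^sup>2 + \<i>\<^sup>2 = 0\<close>.
  Writing \<open>z = x + \<i> y\<close>, the first coordinate determines \<open>y\<close>, so everything happens on horizontal
  lines. A horizontal tangent vector in the kernel of the differential forces \<open>z\<^sup>3\<close> to be real, and
  then \<open>z\<^sup>6 + 1 > 0\<close>. For injectivity with \<open>y \<noteq> 0\<close>, the second coordinate makes two points \<open>u \<noteq> v\<close>
  on a horizontal line roots of the same cubic \<open>X\<^sup>3 - y\<^sup>2 X - c\<close>; reducing the third coordinate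
  modulo this cubic and expressing everything by \<open>s = y\<^sup>2\<close> and \<open>t = (u + v)\<^sup>2\<close> shows that its
  difference quotient is \<open>(t\<^sup>3 + 17 s t\<^sup>2 - 18 s\<^sup>2 t + 8 s\<^sup>3 + 7) / 7 > 0\<close>. For properness, bounds on
  the first two coordinates bound \<open>x\<^sup>3 y\<^sup>2\<close> linearly in \<open>x\<close>, so the third coordinate is
  \<open>x\<^sup>7 / 7\<close> up to terms of degree three in \<open>x\<close>.
\<close>

lemma has_derivative_Re_vec:
  fixes F :: "'n::finite \<Rightarrow> complex \<Rightarrow> complex"
  assumes "\<And>k. (F k has_field_derivative F' k) (at z)"
  shows "((\<lambda>z. (\<chi> k. Re (F k z)) :: real ^ 'n) has_derivative (\<lambda>v. \<chi> k. Re (F' k * v))) (at z)"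
  unfolding has_derivative_componentwise_within[where f = "\<lambda>z. (\<chi> k. Re (F k z)) :: real ^ 'n"]
proof
  fix b :: "real ^ 'n"
  assume "b \<in> Basis"
  then obtain k where b: "b = axis k 1"
    by (auto simp: Basis_vec_def)
  have "((\<lambda>z. Re (F k z)) has_derivative (\<lambda>v. Re (F' k * v))) (at z)"
    using assms[of k] unfolding has_field_derivative_def by (rule has_derivative_Re)
  then show "((\<lambda>z. (\<chi> k. Re (F k z)) \<bullet> b) has_derivative (\<lambda>v. (\<chi> k. Re (F' k * v)) \<bullet> b)) (at z)"
    by (simp add: b inner_axis)
qed

lemma frechet_derivative_Re_vec:
  fixes F :: "'n::finite \<Rightarrow> complex \<Rightarrow> complex"
  assumes "\<And>k. (F k has_field_derivative F' k) (at z)"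
  shows "frechet_derivative (\<lambda>z. (\<chi> k. Re (F k z)) :: real ^ 'n) (at z) = (\<lambda>v. \<chi> k. Re (F' k * v))"
  by (rule frechet_derivative_at[symmetric]) (rule has_derivative_Re_vec[OF assms])

lemma holomorphic_UNIV_has_deriv:
  "g holomorphic_on UNIV \<Longrightarrow> (g has_field_derivative deriv g z) (at z)"
  by (rule holomorphic_derivI) auto

lemma holomorphic_deriv_mult_const:
  "g holomorphic_on UNIV \<Longrightarrow> (\<lambda>z. deriv g z * v) holomorphic_on UNIV"
  by (intro holomorphic_intros) auto

text \<open>Real parts of entire curves are closed under directional derivatives: in direction
  \<open>v\<close>, each \<open>F k\<close> is replaced by the entire function
  \<open>deriv (F k) z * v\<close>. Hence the induction is over all \<open>F\<close> at
  once.\<close>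

lemma Cn_map_Re_vec:
  fixes F :: "'n::finite \<Rightarrow> complex \<Rightarrow> complex"
  assumes "\<And>k. F k holomorphic_on UNIV"
  shows "Cn_map n (\<lambda>z. (\<chi> k. Re (F k z)) :: real ^ 'n)"
  using assms
proof (induction n arbitrary: F)
  case 0
  then show ?case
    by (auto intro!: continuous_intros holomorphic_on_imp_continuous_on)
next
  case (Suc n)
  note F' = holomorphic_UNIV_has_deriv[OF Suc.prems]
  have "Cn_map n (\<lambda>z. (\<chi> k. Re (deriv (F k) z * v)) :: real ^ 'n)" for v
    by (rule Suc.IH) (rule holomorphic_deriv_mult_const[OF Suc.prems])
  moreover have "(\<lambda>z. (\<chi> k. Re (F k z)) :: real ^ 'n) differentiable at z" for z
    using has_derivative_Re_vec[OF F'] by (rule differentiableI)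
  ultimately show ?case
    by (simp only: Cn_map.simps frechet_derivative_Re_vec[OF F']) blast
qed

lemma harmonic_map_Re_vec:
  fixes F :: "'n::finite \<Rightarrow> complex \<Rightarrow> complex"
  assumes F: "\<And>k. F k holomorphic_on UNIV"
  shows "harmonic_map (\<lambda>z. (\<chi> k. Re (F k z)) :: real ^ 'n)"
proof -
  have d2: "((\<lambda>z. deriv (F k) z * v) has_field_derivative deriv (deriv (F k)) z * v) (at z)" for k v z
    using holomorphic_UNIV_has_deriv[OF holomorphic_deriv[OF F]] by (auto intro!: derivative_eq_intros)
  show ?thesis
    unfolding harmonic_map_def smooth_map_def laplacian_def
      frechet_derivative_Re_vec[OF holomorphic_UNIV_has_deriv[OF F]] frechet_derivative_Re_vec[OF d2]
    by (simp add: Cn_map_Re_vec F Basis_complex_def vec_eq_iff)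
qed

lemma Re_integral_primitive:
  fixes \<phi> :: "complex \<Rightarrow> complex ^ 'n::finite"
  assumes "\<And>k w. (G k has_field_derivative \<phi> w $ k) (at w)"
  shows "Re_integral z0 \<phi> z = (\<chi> k. Re (G k z - G k z0))"
proof -
  have "contour_integral (linepath z0 z) (\<lambda>w. \<phi> w $ k) = G k z - G k z0" for k
    using contour_integral_primitive[of UNIV "G k" "\<lambda>w. \<phi> w $ k" "linepath z0 z"] assms
    by (simp add: contour_integral_unique)
  then show ?thesis
    by (simp add: Re_integral_def)
qed

text \<open>The real part of \<open>z ^ 7 / 7 + z\<close> at \<open>z = x + \<i> y\<close>, the
  third coordinate up to its value at the base point.\<close>

definition third :: "real \<Rightarrow> real \<Rightarrow> real" where
  "third x y = x ^ 7 / 7 - 3 * x ^ 5 * y\<^sup>2 + 5 * x ^ 3 * y ^ 4 - x * y ^ 6 + x"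

lemma Im_power4: "Im (z ^ 4) = 4 * ((Re z) ^ 3 * Im z - Re z * (Im z) ^ 3)"
  by (simp add: eval_nat_numeral algebra_simps)

lemma Re_power7_plus: "Re (z ^ 7 / 7 + z) = third (Re z) (Im z)"
  by (simp add: third_def eval_nat_numeral) algebra

text \<open>The quadratic form \<open>17 * t\<^sup>2 - 18 * s * t + 8 * s\<^sup>2\<close> has
  negative discriminant, so completing the square shows it nonnegative; \<open>s\<close> times it,
  plus \<open>t ^ 3\<close>, plus 7 is the claimed expression.\<close>

lemma quotient_pos:
  fixes s t :: real
  assumes "s \<ge> 0" "t \<ge> 0"
  shows "t ^ 3 + 17 * s * t\<^sup>2 - 18 * s\<^sup>2 * t + 8 * s ^ 3 + 7 > 0"
proof -
  have "17 * t\<^sup>2 - 18 * s * t + 8 * s\<^sup>2 = 17 * (t - 9 / 17 * s)\<^sup>2 + 55 / 17 * s\<^sup>2"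
    by (simp add: power2_eq_square algebra_simps)
  then have "s * (17 * t\<^sup>2 - 18 * s * t + 8 * s\<^sup>2) \<ge> 0"
    using assms by simp
  moreover have "t ^ 3 \<ge> 0"
    using assms by simp
  ultimately show ?thesis
    by (simp add: algebra_simps power2_eq_square power3_eq_cube)
qed

lemma third_inj:
  assumes 2: "u ^ 3 * y - u * y ^ 3 = v ^ 3 * y - v * y ^ 3" and 3: "third u y = third v y"
  shows "u = v"
proof (cases "y = 0")
  case True
  \<comment> \<open>On the real axis only \<open>x ^ 7 / 7 + x\<close> remains; the linear term
    makes the monotonicity strict.\<close>
  have mono: "third a 0 < third b 0" if "a < b" for a b
    using power_mono_odd[of 7 a b] that by (simp add: third_def)
  show ?thesis
    using 3 mono[of u v] mono[of v u] True by (cases u v rule: linorder_cases) auto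
next
  case False
  show ?thesis
  proof (rule ccontr)
    assume "u \<noteq> v"
    have "y * (u - v) * (u\<^sup>2 + u * v + v\<^sup>2 - y\<^sup>2) = 0"
      using 2 by algebra
    then have s: "y\<^sup>2 = u\<^sup>2 + u * v + v\<^sup>2"
      using False \<open>u \<noteq> v\<close> by simp
    define S where "S = y\<^sup>2"
    define T where "T = (u + v)\<^sup>2"
    have y46: "y ^ 4 = S\<^sup>2" "y ^ 6 = S ^ 3"
      by (simp_all add: S_def flip: power_mult)
    have third: "7 * third x y = x ^ 7 - 21 * x ^ 5 * S + 35 * x ^ 3 * S\<^sup>2 - 7 * x * S ^ 3 + 7 * x" for x
      unfolding third_def y46 by (simp add: S_def algebra_simps)
    \<comment> \<open>Eliminating \<open>y\<close> by means of \<open>s\<close> leaves a polynomial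
      identity in \<open>u\<close> and \<open>v\<close>.\<close>
    have "7 * third u y - 7 * third v y
        = (u - v) * (T ^ 3 + 17 * S * T\<^sup>2 - 18 * S\<^sup>2 * T + 8 * S ^ 3 + 7)"
      unfolding third unfolding S_def s T_def by algebra
    moreover have "T ^ 3 + 17 * S * T\<^sup>2 - 18 * S\<^sup>2 * T + 8 * S ^ 3 + 7 > 0"
      by (rule quotient_pos) (auto simp: S_def T_def)
    ultimately show False
      using 3 \<open>u \<noteq> v\<close> by simp
  qed
qed

lemma third_bound:
  fixes x y M :: real
  assumes M: "M \<ge> 0" and 1: "\<bar>y\<bar> \<le> M" and 2: "\<bar>x ^ 3 * y - x * y ^ 3\<bar> \<le> M" and 3: "\<bar>third x y\<bar> \<le> M"
  shows "\<bar>x\<bar> \<le> 1 + 7 * (1 + M + 3 * M\<^sup>2 + 2 * M ^ 4 + M ^ 6)"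
proof (cases "\<bar>x\<bar> \<le> 1")
  case True
  have "0 \<le> 7 * (1 + M + 3 * M\<^sup>2 + 2 * M ^ 4 + M ^ 6)"
    using M by simp
  with True show ?thesis
    by (rule add_increasing2[rotated])
next
  case False
  define c where "c = x ^ 3 * y - x * y ^ 3"
  \<comment> \<open>\<open>C\<close> sums the coefficients in the estimate below, once every power
    of \<open>r\<close> there is raised to \<open>r ^ 3\<close>, which is possible because
    \<open>r \<ge> 1\<close>.\<close>
  define C where "C = 1 + M + 3 * M\<^sup>2 + 2 * M ^ 4 + M ^ 6"
  define r where "r = \<bar>x\<bar>"
  have r: "r \<ge> 1"
    using False by (simp add: r_def)
  have r13: "r \<le> r ^ 3" "r\<^sup>2 \<le> r ^ 3" "1 \<le> r ^ 3" "r \<le> r ^ 4"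
    using r power_increasing[of 1 3 r] power_increasing[of 2 3 r] power_increasing[of 0 3 r]
      power_increasing[of 1 4 r] by simp_all
  have yp: "\<bar>y ^ n\<bar> \<le> M ^ n" for n
    using 1 by (simp add: power_abs power_mono)
  \<comment> \<open>Substituting \<open>x ^ 3 * y\<^sup>2 = y * c + x * y ^ 4\<close> removes the
    term of degree five in \<open>x\<close>.\<close>
  have eq: "x ^ 7 / 7 = third x y - x + 3 * x\<^sup>2 * (y * c) - 2 * x ^ 3 * y ^ 4 + x * y ^ 6"
    unfolding third_def c_def by (simp add: field_simps) algebra
  have yc: "\<bar>y * c\<bar> \<le> M\<^sup>2"
    using 1 2 M unfolding c_def abs_mult power2_eq_square by (intro mult_mono) auto
  have "\<bar>x ^ 7 / 7\<bar> \<le> \<bar>third x y\<bar> + \<bar>x\<bar> + \<bar>3 * x\<^sup>2 * (y * c)\<bar> + \<bar>2 * x ^ 3 * y ^ 4\<bar> + \<bar>x * y ^ 6\<bar>"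
    unfolding eq by arith
  also have "\<dots> = \<bar>third x y\<bar> + r + 3 * r\<^sup>2 * \<bar>y * c\<bar> + 2 * r ^ 3 * \<bar>y ^ 4\<bar> + r * \<bar>y ^ 6\<bar>"
    by (simp add: r_def abs_mult power_abs)
  also have "\<dots> \<le> M * r ^ 3 + r ^ 3 + 3 * r ^ 3 * M\<^sup>2 + 2 * r ^ 3 * M ^ 4 + r ^ 3 * M ^ 6"
  proof (intro add_mono)
    show "\<bar>third x y\<bar> \<le> M * r ^ 3"
      using 3 mult_left_mono[OF r13(3) M] by linarith
  qed (use r r13 yc yp[of 4] yp[of 6] M in \<open>auto intro!: mult_mono\<close>)
  also have "\<dots> = r ^ 3 * C"
    by (simp add: C_def algebra_simps)
  finally have "r ^ 7 / 7 \<le> r ^ 3 * C"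
    by (simp add: r_def power_abs)
  then have "r ^ 3 * r ^ 4 \<le> r ^ 3 * (7 * C)"
    by (simp flip: power_add)
  then have "r ^ 4 \<le> 7 * C"
    using r by (simp only: mult_le_cancel_left_pos zero_less_power)
  then show ?thesis
    using r13(4) unfolding r_def C_def by linarith
qed

theorem proposition3p3:
  fixes z0 :: complex and f :: "complex \<Rightarrow> real ^ 3"
  assumes f_def: "f = Re_integral z0 (\<lambda>z. vector [\<i>, \<i> * z ^ 3, z ^ 6 + 1])"
  shows "harmonic_map f \<and> regular_proper_embedding f"
proof -
  define \<phi> :: "complex \<Rightarrow> complex ^ 3" where "\<phi> = (\<lambda>z. vector [\<i>, \<i> * z ^ 3, z ^ 6 + 1])"
  define P :: "complex \<Rightarrow> complex ^ 3" where "P = (\<lambda>z. vector [\<i> * z, \<i> * z ^ 4 / 4, z ^ 7 / 7 + z])"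
  \<comment> \<open>Normalised to vanish at \<open>z0\<close>, so that \<open>f\<close> is exactly
    the real part of \<open>F\<close>.\<close>
  define F where "F = (\<lambda>k z. P z $ k - P z0 $ k)"
  have P': "((\<lambda>z. P z $ k) has_field_derivative \<phi> w $ k) (at w)" for k w
    using exhaust_3[of k] unfolding P_def \<phi>_def
    by (auto intro!: derivative_eq_intros)
  have F': "(F k has_field_derivative \<phi> w $ k) (at w)" for k w
    unfolding F_def by (rule derivative_eq_intros P' refl)+ simp
  have f: "f = (\<lambda>z. \<chi> k. Re (F k z))"
    unfolding f_def F_def using Re_integral_primitive[of "\<lambda>k z. P z $ k" \<phi>, OF P']
    by (auto simp: \<phi>_def)
  have "harmonic_map f"
    unfolding f using F' by (intro harmonic_map_Re_vec) (auto simp: holomorphic_on_open)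
  then have smooth: "smooth_map f"
    by (simp add: harmonic_map_def)
  have f1: "f z $ 1 = Im z0 - Im z" for z
    by (simp add: f F_def P_def)
  have f2: "f z $ 2 = (Re z0 ^ 3 * Im z0 - Re z0 * Im z0 ^ 3) - (Re z ^ 3 * Im z - Re z * Im z ^ 3)"
    for z
    by (simp add: f F_def P_def Im_power4 field_simps)
  have f3: "f z $ 3 = third (Re z) (Im z) - third (Re z0) (Im z0)" for z
    by (simp add: f F_def P_def flip: Re_power7_plus)
  have "immersion f"
    unfolding immersion_def
  proof (intro conjI allI smooth)
    fix z
    have D: "frechet_derivative f (at z) = (\<lambda>v. \<chi> k. Re (\<phi> z $ k * v))"
      unfolding f by (rule frechet_derivative_Re_vec[OF F'])
    have "linear (frechet_derivative f (at z))"
      using has_derivative_Re_vec[of F "\<lambda>k. \<phi> z $ k", OF F'] unfolding D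
      by (rule has_derivative_linear)
    moreover have "v = 0" if "frechet_derivative f (at z) v = 0" for v
    proof -
      have k: "Re (\<phi> z $ k * v) = 0" for k
        using that unfolding D vec_eq_iff by simp
      have v: "Im v = 0"
        using k[of 1] by (simp add: \<phi>_def)
      have 2: "Im (z ^ 3) * Re v = 0"
        using k[of 2] v by (simp add: \<phi>_def)
      have 3: "(Re (z ^ 6) + 1) * Re v = 0"
        using k[of 3] v by (simp add: \<phi>_def)
      \<comment> \<open>If \<open>Re v\<close> were nonzero, \<open>2\<close> would make the
        right-hand side a square, and the factor \<open>Re (z ^ 6) + 1\<close> in \<open>3\<close>
        would be positive.\<close>
      have "Re (z ^ 6) = (Re (z ^ 3))\<^sup>2 - (Im (z ^ 3))\<^sup>2"
        unfolding power2_eq_square times_complex.simps(1)[symmetric] by (simp flip: power_add)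
      then have "Re v = 0"
        using 2 3 by (smt (verit) mult_eq_0_iff zero_le_power2 zero_eq_power2)
      then show "v = 0"
        using v by (simp add: complex_eq_iff)
    qed
    ultimately show "inj (frechet_derivative f (at z))"
      by (simp add: linear_injective_0)
  qed
  moreover have "inj f"
  proof (rule injI)
    fix u v
    assume "f u = f v"
    then have Im: "Im u = Im v" and
      "Re u ^ 3 * Im v - Re u * Im v ^ 3 = Re v ^ 3 * Im v - Re v * Im v ^ 3"
      "third (Re u) (Im v) = third (Re v) (Im v)"
      using f1[of u] f1[of v] f2[of u] f2[of v] f3[of u] f3[of v] by auto
    with third_inj[of "Re u" "Im v" "Re v"] show "u = v"
      by (simp only: complex_eq_iff)
  qed
  moreover have cont: "continuous_on UNIV f"
    using smooth unfolding smooth_map_def by (metis Cn_map.simps(1))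
  moreover have "compact (f -` K)" if K: "compact K" for K
  proof -
    obtain B where B: "\<And>w. w \<in> K \<Longrightarrow> norm w \<le> B"
      using compact_imp_bounded[OF K] unfolding bounded_iff by blast
    \<comment> \<open>The base-point values convert bounds on the coordinates of \<open>f\<close>
      into bounds on the polynomials themselves. The absolute value guards against a negative
      \<open>B\<close>, possible for empty \<open>K\<close>.\<close>
    define M where "M = \<bar>B\<bar> + \<bar>Im z0\<bar> + \<bar>Re z0 ^ 3 * Im z0 - Re z0 * Im z0 ^ 3\<bar>
      + \<bar>third (Re z0) (Im z0)\<bar>"
    have "norm z \<le> (1 + 7 * (1 + M + 3 * M\<^sup>2 + 2 * M ^ 4 + M ^ 6)) + M" if "z \<in> f -` K" for z
    proof -
      have k: "\<bar>f z $ k\<bar> \<le> B" for k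
        using B[of "f z"] that component_le_norm_cart[of "f z" k] by auto
      have y: "\<bar>Im z\<bar> \<le> M"
        using k[of 1] unfolding f1 M_def by arith
      moreover have "\<bar>Re z\<bar> \<le> 1 + 7 * (1 + M + 3 * M\<^sup>2 + 2 * M ^ 4 + M ^ 6)"
      proof (rule third_bound[OF _ y])
        show "\<bar>Re z ^ 3 * Im z - Re z * Im z ^ 3\<bar> \<le> M"
          using k[of 2] unfolding f2 M_def by arith
        show "\<bar>third (Re z) (Im z)\<bar> \<le> M"
          using k[of 3] unfolding f3 M_def by arith
      qed (simp add: M_def)
      ultimately show ?thesis
        using cmod_le[of z] by linarith
    qed
    then have "bounded (f -` K)"
      unfolding bounded_iff by blast
    moreover have "closed (f -` K)"
      using cont compact_imp_closed[OF K] by (simp add: continuous_on_closed_vimage)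
    ultimately show ?thesis
      by (simp add: compact_eq_bounded_closed)
  qed
  ultimately show ?thesis
    using \<open>harmonic_map f\<close> proper_map_euclidean_iff[OF cont] by (simp add: regular_proper_embedding_def)
qed

end
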